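(* Let $n\ge 1$ be an integer, let $(x_1,\dots,x_n)$ be an orthonormal basis of $\mathbb R^n$, and let $\ell_1,\dots,\ell_n:\mathbb R^n\to\mathbb R$ be linear functionals such that $\ell_i(x_i)=1$ for every $i\in\{1,\dots,n\}$. Then for any real numbers $c_1,\dots,c_n$ there is a point $z\in\mathbb R^n$ such that $\|z\|\le\sqrt n$ and $|\ell_i(z)-c_i|\ge 1$ for all $i\in\{1,\dots,n\}$.
   Context: $\mathbb R^n$ carries its standard Euclidean inner product, $\|\cdot\|$ denotes the corresponding Euclidean norm, and orthonormality is with respect to this inner product. *)

theory Defs
  imports "HOL-Analysis.Analysis"
begin

(* A basis given as an indexed family: distinctness of the vectors follows from orthonormality. *)
definition orthonormal_basis :: "('n::finite \<Rightarrow> real ^ 'n) \<Rightarrow> bool" where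
  "orthonormal_basis x \<longleftrightarrow>
     (\<forall>i j. x i \<bullet> x j = (if i = j then 1 else 0)) \<and>
     independent (range x) \<and> span (range x) = UNIV"

end

theory Submission
  imports Defs
begin

text \<open>
  Bang's sign argument handles symmetric matrices; the matrix of the \<open>l i\<close> in the basis \<open>x\<close> need
  not be symmetric. Among all orthonormal families \<open>u\<close> pick one minimising the sum of
  \<open>1 / (l i (u i))\<^sup>2\<close>. Stationarity under rotations in the plane of \<open>u p\<close> and \<open>u q\<close> says precisely
  that the matrix \<open>l p (u q) / (l p (u p)) ^ 3\<close> is symmetric. Its diagonal is positive, so signs can be
  chosen for which the vector \<open>z\<close> with coordinates \<open>\<plusminus> 1 / l i (u i)\<close> in \<open>u\<close> avoids all slabs. Comparing
  the minimiser with \<open>x\<close>, the squared norm of \<open>z\<close> is at most \<open>n\<close>.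
\<close>

text \<open>By symmetry the row and column cross terms of a one-coordinate change agree, hence the
  factor 2. It serves to measure the effect of a single sign flip.\<close>

lemma quadratic_form_update:
  fixes H :: "'n::finite \<Rightarrow> 'n \<Rightarrow> real"
  assumes "\<And>i j. H i j = H j i"
  shows "(\<Sum>i\<in>UNIV. \<Sum>j\<in>UNIV. H i j * (w(k := w k + t)) i * (w(k := w k + t)) j) =
    (\<Sum>i\<in>UNIV. \<Sum>j\<in>UNIV. H i j * w i * w j) + 2 * t * (\<Sum>j\<in>UNIV. H k j * w j) + t\<^sup>2 * H k k"
proof -
  let ?d = "\<lambda>i. if i = k then t else 0"
  have "(w(k := w k + t)) i = w i + ?d i" for i
    by simp
  then have "(\<Sum>i\<in>UNIV. \<Sum>j\<in>UNIV. H i j * (w(k := w k + t)) i * (w(k := w k + t)) j) =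
      (\<Sum>i\<in>UNIV. \<Sum>j\<in>UNIV. H i j * w i * w j + H i j * w i * ?d j + (?d i * (H i j * w j) + ?d i * (H i j * ?d j)))"
    by (intro sum.cong refl) (simp only: algebra_simps)
  also have "\<dots> = (\<Sum>i\<in>UNIV. \<Sum>j\<in>UNIV. H i j * w i * w j) + (\<Sum>i\<in>UNIV. \<Sum>j\<in>UNIV. H i j * w i * ?d j)
      + ((\<Sum>i\<in>UNIV. ?d i * (\<Sum>j\<in>UNIV. H i j * w j)) + (\<Sum>i\<in>UNIV. ?d i * (\<Sum>j\<in>UNIV. H i j * ?d j)))"
    by (simp only: sum.distrib sum_distrib_left)
  also have "(\<Sum>i\<in>UNIV. \<Sum>j\<in>UNIV. H i j * w i * ?d j) = t * (\<Sum>i\<in>UNIV. H k i * w i)"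
    using assms by (simp add: if_distrib[of "\<lambda>y. _ * y"] sum_distrib_left mult_ac cong: if_cong)
  also have "(\<Sum>i\<in>UNIV. ?d i * (\<Sum>j\<in>UNIV. H i j * w j)) = t * (\<Sum>i\<in>UNIV. H k i * w i)"
    by (simp add: if_distrib[of "\<lambda>y. y * _"] cong: if_cong)
  also have "(\<Sum>i\<in>UNIV. ?d i * (\<Sum>j\<in>UNIV. H i j * ?d j)) = t\<^sup>2 * H k k"
    by (simp add: if_distrib[of "\<lambda>y. y * _"] if_distrib[of "\<lambda>y. _ * y"] power2_eq_square mult_ac cong: if_cong)
  finally show ?thesis
    by simp
qed

text \<open>A maximiser of \<open>F\<close> over the finitely many sign patterns works: flipping its
  \<open>k\<close>-th sign cannot increase \<open>F\<close>, and this is the \<open>k\<close>-th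
  inequality.\<close>

lemma Bang_signs:
  fixes H :: "'n::finite \<Rightarrow> 'n \<Rightarrow> real" and s m :: "'n \<Rightarrow> real"
  assumes sym: "\<And>i j. H i j = H j i" and s: "\<And>i. s i > 0"
  obtains w where "\<And>i. \<bar>w i\<bar> = s i" "\<And>i. \<bar>(\<Sum>j\<in>UNIV. H i j * w j) - m i\<bar> \<ge> H i i * s i"
proof -
  define W where "W = (\<Pi>\<^sub>E i\<in>UNIV. {s i, - s i})"
  define F where "F w = (\<Sum>i\<in>UNIV. \<Sum>j\<in>UNIV. H i j * w i * w j) - 2 * (\<Sum>i\<in>UNIV. m i * w i)" for w
  have "finite W" "s \<in> W"
    by (auto simp: W_def intro: finite_PiE)
  then obtain w where w: "w \<in> W" "\<And>v. v \<in> W \<Longrightarrow> F v \<le> F w"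
    using ex_is_arg_min_if_finite[of W "\<lambda>v. - F v"]
    by (auto simp: is_arg_min_linorder)
  have abs_w: "\<bar>w i\<bar> = s i" for i
    using w(1) s[of i] by (auto simp: W_def PiE_iff dest!: spec[of _ i])
  moreover have "\<bar>(\<Sum>j\<in>UNIV. H k j * w j) - m k\<bar> \<ge> H k k * s k" for k
  proof -
    \<comment> \<open>The flip of \<open>w k\<close> to \<open>- w k\<close>, written as an
      increment to match \<open>quadratic_form_update\<close>.\<close>
    define v where "v = w(k := w k + (- 2 * w k))"
    define R where "R = (\<Sum>j\<in>UNIV. H k j * w j)"
    have "v \<in> W"
      using w(1) by (auto simp: W_def PiE_iff v_def dest: spec[of _ k])
    then have "F v \<le> F w"
      by (rule w(2))
    moreover have "(\<Sum>i\<in>UNIV. m i * v i) = (\<Sum>i\<in>UNIV. m i * w i) + m k * (- 2 * w k)"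
      by (simp add: v_def sum.remove[of UNIV k] algebra_simps)
    \<comment> \<open>The flip changes \<open>F\<close> by
      \<open>4 * (H k k * (w k)\<^sup>2 - w k * (R - m k))\<close>, which is at most 0.\<close>
    ultimately have "H k k * (w k)\<^sup>2 \<le> w k * (R - m k)"
      using quadratic_form_update[of H w k "- 2 * w k", OF sym, folded v_def]
      by (simp add: F_def R_def power2_eq_square algebra_simps)
    also have "\<dots> \<le> s k * \<bar>R - m k\<bar>"
      by (metis abs_ge_self abs_mult abs_w)
    finally have "s k * (H k k * s k) \<le> s k * \<bar>R - m k\<bar>"
      by (simp add: power2_eq_square mult_ac flip: abs_w)
    then show ?thesis
      using s[of k] by (simp add: R_def)
  qed
  ultimately show thesis
    using that by blast
qed

text \<open>First-order condition at the local minimum \<open>t = 0\<close>, where the derivative is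
  \<open>- 2 * (b / a ^ 3) + 2 * (e / d ^ 3)\<close>.\<close>

lemma rotation_stationary:
  fixes a b d e :: real
  assumes "a \<noteq> 0" "d \<noteq> 0"
    and min: "\<And>t. cos t * a + sin t * b \<noteq> 0 \<Longrightarrow> cos t * d - sin t * e \<noteq> 0 \<Longrightarrow>
      1 / a\<^sup>2 + 1 / d\<^sup>2 \<le> 1 / (cos t * a + sin t * b)\<^sup>2 + 1 / (cos t * d - sin t * e)\<^sup>2"
  shows "b / a ^ 3 = e / d ^ 3"
proof -
  let ?f = "\<lambda>t. 1 / (cos t * a + sin t * b)\<^sup>2 + 1 / (cos t * d - sin t * e)\<^sup>2"
  have deriv: "(?f has_real_derivative (- 2 * (b / a ^ 3) + 2 * (e / d ^ 3))) (at 0)"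
    using assms(1,2)
    by (auto intro!: derivative_eq_intros) (simp add: field_simps power2_eq_square power3_eq_cube power4_eq_xxxx)
  \<comment> \<open>Minimality is assumed only for nonzero denominators; by continuity both stay
    nonzero near 0.\<close>
  have "\<forall>\<^sub>F t in at 0. cos t * a + sin t * b \<noteq> 0"
    by (rule tendsto_imp_eventually_ne[of _ a]) (auto intro!: tendsto_eq_intros simp: assms)
  moreover have "\<forall>\<^sub>F t in at 0. cos t * d - sin t * e \<noteq> 0"
    by (rule tendsto_imp_eventually_ne[of _ d]) (auto intro!: tendsto_eq_intros simp: assms)
  ultimately have "\<forall>\<^sub>F t in at 0. ?f 0 \<le> ?f t"
    by eventually_elim (use min in simp)
  then obtain r where "r > 0" "\<And>t. t \<noteq> 0 \<Longrightarrow> dist t 0 < r \<Longrightarrow> ?f 0 \<le> ?f t"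
    unfolding eventually_at by auto
  then have "\<forall>t. \<bar>0 - t\<bar> < r \<longrightarrow> ?f 0 \<le> ?f t"
    by (metis abs_minus_commute dist_real_def order_refl)
  then have "- 2 * (b / a ^ 3) + 2 * (e / d ^ 3) = 0"
    using DERIV_local_min[OF deriv \<open>r > 0\<close>] by blast
  then show ?thesis
    by simp
qed

definition orthonormal_family :: "('n \<Rightarrow> 'a::real_inner) \<Rightarrow> bool" where
  "orthonormal_family u \<longleftrightarrow> (\<forall>i j. u i \<bullet> u j = (if i = j then 1 else 0))"

lemma orthonormal_family_rotate:
  assumes "orthonormal_family u" "p \<noteq> q"
  shows "orthonormal_family (u(p := cos t *\<^sub>R u p + sin t *\<^sub>R u q, q := cos t *\<^sub>R u q - sin t *\<^sub>R u p))"
proof -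
  have "cos t * cos t + sin t * sin t = 1"
    by (metis power2_eq_square sin_cos_squared_add2)
  then show ?thesis
    using assms unfolding orthonormal_family_def
    by (auto simp: inner_simps algebra_simps)
qed

lemma norm_orthonormal_family_sum:
  fixes u :: "'n::finite \<Rightarrow> 'a::real_inner"
  assumes "orthonormal_family u"
  shows "(norm (\<Sum>i\<in>UNIV. w i *\<^sub>R u i))\<^sup>2 = (\<Sum>i\<in>UNIV. (w i)\<^sup>2)"
  using assms unfolding orthonormal_family_def power2_norm_eq_inner
  by (simp add: inner_sum_left inner_sum_right power2_eq_square
      if_distrib[of "\<lambda>y. _ * y"] cong: if_cong)

text \<open>Encoding families as elements of the Euclidean space \<open>'a ^ 'n\<close> makes
  Heine-Borel available: unit vectors give boundedness, continuous equations give
  closedness.\<close>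

lemma compact_orthonormal_families:
  "compact {u :: 'a::euclidean_space ^ 'n. orthonormal_family (($) u)}"
proof -
  have "bounded {u :: 'a ^ 'n. orthonormal_family (($) u)}"
  proof (rule boundedI)
    fix u :: "'a ^ 'n"
    assume "u \<in> {u. orthonormal_family (($) u)}"
    then have "norm (u $ i) = 1" for i
      by (simp add: orthonormal_family_def norm_eq_sqrt_inner)
    then show "norm u \<le> sqrt (real CARD('n))"
      by (simp add: norm_vec_def L2_set_def)
  qed
  moreover have "closed {u :: 'a ^ 'n. orthonormal_family (($) u)}"
    unfolding orthonormal_family_def
    by (intro closed_Collect_all closed_Collect_eq continuous_intros)
  ultimately show ?thesis
    by (simp add: compact_eq_bounded_closed)
qed

text \<open>The condition \<open>l i (v i) \<noteq> 0\<close> is not closed, but the sum blows up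
  where it fails, so the infimum is attained on a compact sublevel region.\<close>

lemma minimal_orthonormal_family:
  fixes l :: "'n::finite \<Rightarrow> 'a::euclidean_space \<Rightarrow> real"
  assumes lin: "\<And>i. linear (l i)" and x: "orthonormal_family x" and lx: "\<And>i. l i (x i) \<noteq> 0"
  obtains u where "orthonormal_family u" "\<And>i. l i (u i) \<noteq> 0"
    "\<And>v. orthonormal_family v \<Longrightarrow> (\<And>i. l i (v i) \<noteq> 0) \<Longrightarrow>
      (\<Sum>i\<in>UNIV. 1 / (l i (u i))\<^sup>2) \<le> (\<Sum>i\<in>UNIV. 1 / (l i (v i))\<^sup>2)"
proof -
  define f where "f v = (\<Sum>i\<in>UNIV. 1 / (l i (v $ i))\<^sup>2)" for v :: "'a ^ 'n"
  define M where "M = f (vec_lambda x)"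
  \<comment> \<open>Cutting off small denominators keeps the domain compact and loses only families
      whose value exceeds the one at \<open>x\<close>.\<close>
  define S where "S = {v :: 'a ^ 'n. orthonormal_family (($) v)} \<inter> {v. \<forall>i. 1 \<le> M * (l i (v $ i))\<^sup>2}"
  have le_f: "1 / (l i (v $ i))\<^sup>2 \<le> f v" for i and v :: "'a ^ 'n"
    unfolding f_def by (rule member_le_sum) auto
  have cont: "continuous_on A (\<lambda>v::'a ^ 'n. l i (v $ i))" for A i
    by (intro linear_continuous_on_compose[OF _ lin] continuous_intros)
  have in_S: "v \<in> S" if "orthonormal_family (($) v)" "\<And>i. l i (v $ i) \<noteq> 0" "f v \<le> M" for v :: "'a ^ 'n"
  proof -
    have "1 / (l i (v $ i))\<^sup>2 \<le> M" for i
      using le_f[of i v] that(3) by linarith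
    then show ?thesis
      using that(1,2) by (simp add: S_def divide_le_eq)
  qed
  have "x = ($) (vec_lambda x)"
    by auto
  then have "vec_lambda x \<in> S"
    using x lx by (intro in_S) (auto simp: M_def)
  moreover have "compact S"
    unfolding S_def
    by (intro compact_Int_closed compact_orthonormal_families closed_Collect_all closed_Collect_le
        continuous_intros cont)
  \<comment> \<open>The bound defining \<open>S\<close> is free of division, hence closed, and a
    zero of \<open>l i (v $ i)\<close> would turn it into \<open>1 \<le> 0\<close>.\<close>
  moreover have nz: "l i (v $ i) \<noteq> 0" if "v \<in> S" for v i
    using that by (auto simp: S_def dest!: spec[of _ i])
  moreover have "continuous_on S f"
    unfolding f_def by (intro continuous_intros cont) (use nz in auto)
  ultimately obtain u where u: "u \<in> S" "\<And>v. v \<in> S \<Longrightarrow> f u \<le> f v"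
    using continuous_attains_inf[of S f] by blast
  show thesis
  proof
    show "orthonormal_family (($) u)" "\<And>i. l i (u $ i) \<noteq> 0"
      using u(1) nz by (auto simp: S_def)
    fix v
    assume v: "orthonormal_family v" "\<And>i. l i (v i) \<noteq> 0"
    have "v = ($) (vec_lambda v)"
      by auto
    \<comment> \<open>Competitors with value at most \<open>M\<close> lie in \<open>S\<close>; the
      others exceed \<open>M\<close>, which is at least \<open>f u\<close> because \<open>x\<close>
      itself yields a point of \<open>S\<close>.\<close>
    then have "f u \<le> f (vec_lambda v)" if "f (vec_lambda v) \<le> M"
      using v that by (intro u(2) in_S) auto
    moreover have "f u \<le> M"
      using u(2) \<open>vec_lambda x \<in> S\<close> by (simp add: M_def)
    ultimately have "f u \<le> f (vec_lambda v)"
      by linarith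
    then show "(\<Sum>i\<in>UNIV. 1 / (l i (u $ i))\<^sup>2) \<le> (\<Sum>i\<in>UNIV. 1 / (l i (v i))\<^sup>2)"
      by (simp add: f_def)
  qed
qed

text \<open>Rotating \<open>u p\<close> and \<open>u q\<close> in their plane changes only the
  summands at \<open>p\<close> and \<open>q\<close>, so \<open>rotation_stationary\<close> applies
  to these two.\<close>

lemma minimal_orthonormal_family_symmetric:
  fixes l :: "'n::finite \<Rightarrow> 'a::euclidean_space \<Rightarrow> real"
  assumes lin: "\<And>i. linear (l i)" and u: "orthonormal_family u" and nz: "\<And>i. l i (u i) \<noteq> 0"
    and min: "\<And>v. orthonormal_family v \<Longrightarrow> (\<And>i. l i (v i) \<noteq> 0) \<Longrightarrow>
      (\<Sum>i\<in>UNIV. 1 / (l i (u i))\<^sup>2) \<le> (\<Sum>i\<in>UNIV. 1 / (l i (v i))\<^sup>2)"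
  shows "l p (u q) / (l p (u p)) ^ 3 = l q (u p) / (l q (u q)) ^ 3"
proof (cases "p = q")
  case False
  show ?thesis
  proof (rule rotation_stationary[OF nz nz])
    fix t :: real
    let ?v = "u(p := cos t *\<^sub>R u p + sin t *\<^sub>R u q, q := cos t *\<^sub>R u q - sin t *\<^sub>R u p)"
    assume ne: "cos t * l p (u p) + sin t * l p (u q) \<noteq> 0" "cos t * l q (u q) - sin t * l q (u p) \<noteq> 0"
    have v: "l p (?v p) = cos t * l p (u p) + sin t * l p (u q)"
      "l q (?v q) = cos t * l q (u q) - sin t * l q (u p)"
      using False lin by (simp_all add: linear_add linear_diff linear_scale)
    have split: "(\<Sum>i\<in>UNIV. g i) = g p + g q + (\<Sum>i\<in>UNIV - {p, q}. g i)" for g :: "'n \<Rightarrow> real"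
      using False by (subst sum.subset_diff[of "{p, q}"]) auto
    have "l i (?v i) \<noteq> 0" for i
      using v ne nz[of i] by (cases "i = p"; cases "i = q") auto
    then have "(\<Sum>i\<in>UNIV. 1 / (l i (u i))\<^sup>2) \<le> (\<Sum>i\<in>UNIV. 1 / (l i (?v i))\<^sup>2)"
      by (intro min orthonormal_family_rotate u False)
    moreover have "(\<Sum>i\<in>UNIV - {p, q}. 1 / (l i (?v i))\<^sup>2) = (\<Sum>i\<in>UNIV - {p, q}. 1 / (l i (u i))\<^sup>2)"
      by (intro sum.cong) auto
    ultimately show "1 / (l p (u p))\<^sup>2 + 1 / (l q (u q))\<^sup>2 \<le>
        1 / (cos t * l p (u p) + sin t * l p (u q))\<^sup>2 + 1 / (cos t * l q (u q) - sin t * l q (u p))\<^sup>2"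
      unfolding split v by linarith
  qed
qed simp

theorem mainTheorem1:
  fixes x :: "'n::finite \<Rightarrow> real ^ 'n"
    and l :: "'n \<Rightarrow> real ^ 'n \<Rightarrow> real"
    and c :: "'n \<Rightarrow> real"
  assumes "orthonormal_basis x"
    and "\<And>i. linear (l i)"
    and "\<And>i. l i (x i) = 1"
  shows "\<exists>z :: real ^ 'n. norm z \<le> sqrt (real CARD('n)) \<and> (\<forall>i. \<bar>l i z - c i\<bar> \<ge> 1)"
proof -
  have x: "orthonormal_family x"
    using assms(1) by (simp add: orthonormal_basis_def orthonormal_family_def)
  obtain u where u: "orthonormal_family u" and nz: "\<And>i. l i (u i) \<noteq> 0"
    and min: "\<And>v. orthonormal_family v \<Longrightarrow> (\<And>i. l i (v i) \<noteq> 0) \<Longrightarrow>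
      (\<Sum>i\<in>UNIV. 1 / (l i (u i))\<^sup>2) \<le> (\<Sum>i\<in>UNIV. 1 / (l i (v i))\<^sup>2)"
    using minimal_orthonormal_family[of l x] assms x by auto
  define b where "b i = l i (u i)" for i
  \<comment> \<open>Scaling row \<open>i\<close> by \<open>1 / b i ^ 3\<close> gives symmetry and
    the positive diagonal \<open>1 / (b i)\<^sup>2\<close>.\<close>
  define H where "H i j = l i (u j) / b i ^ 3" for i j
  have sym: "H i j = H j i" for i j
    unfolding H_def b_def by (rule minimal_orthonormal_family_symmetric[OF assms(2) u nz min])
  have b: "b i \<noteq> 0" for i
    by (simp add: b_def nz)
  then have "1 / \<bar>b i\<bar> > 0" for i
    by simp
  \<comment> \<open>The centres \<open>c i\<close> are scaled like the rows. With
    \<open>\<bar>w i\<bar> = 1 / \<bar>b i\<bar>\<close> the guaranteed gap is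
    \<open>1 / \<bar>b i ^ 3\<bar>\<close>, that is, 1 after undoing the scaling.\<close>
  with sym obtain w where w: "\<And>i. \<bar>w i\<bar> = 1 / \<bar>b i\<bar>"
    "\<And>i. \<bar>(\<Sum>j\<in>UNIV. H i j * w j) - c i / b i ^ 3\<bar> \<ge> H i i * (1 / \<bar>b i\<bar>)"
    by (rule Bang_signs[of H "\<lambda>i. 1 / \<bar>b i\<bar>" "\<lambda>i. c i / b i ^ 3"]) blast
  define z where "z = (\<Sum>j\<in>UNIV. w j *\<^sub>R u j)"
  have "(norm z)\<^sup>2 = (\<Sum>i\<in>UNIV. (w i)\<^sup>2)"
    unfolding z_def by (rule norm_orthonormal_family_sum[OF u])
  also have "\<dots> = (\<Sum>i\<in>UNIV. 1 / (b i)\<^sup>2)"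
    by (metis (no_types, lifting) power2_abs power_one_over w(1))
  also have "\<dots> \<le> (\<Sum>i\<in>UNIV. 1 / (l i (x i))\<^sup>2)"
    unfolding b_def by (intro min x) (simp add: assms(3))
  also have "\<dots> = real CARD('n)"
    by (simp add: assms(3))
  finally have "norm z \<le> sqrt (real CARD('n))"
    by (rule real_le_rsqrt)
  moreover have "\<bar>l i z - c i\<bar> \<ge> 1" for i
  proof -
    have "(\<Sum>j\<in>UNIV. H i j * w j) - c i / b i ^ 3 = (l i z - c i) / b i ^ 3"
      by (simp add: z_def H_def linear_sum[OF assms(2)] linear_scale[OF assms(2)] sum_divide_distrib
          diff_divide_distrib mult_ac)
    moreover have "H i i * (1 / \<bar>b i\<bar>) = 1 / \<bar>b i ^ 3\<bar>"
      using b[of i] by (simp add: H_def power_abs power3_eq_cube abs_mult flip: b_def)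
    ultimately have "1 / \<bar>b i ^ 3\<bar> \<le> \<bar>l i z - c i\<bar> / \<bar>b i ^ 3\<bar>"
      using w(2)[of i] by (simp only: abs_divide)
    then show ?thesis
      using b[of i] by (simp add: divide_le_cancel)
  qed
  ultimately show ?thesis
    by blast
qed

end
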